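(* Let $\mathbb{K}$ be an arbitrary field, let $n \geq 1$, and let $V=\mathbb{K}^n$ with the permutation action of $\mathcal{S}_n$. Assume that $m_0$ is an integer with $m_0 \geq \lfloor \frac{n}{2} \rfloor + 1$ and that $S \subset \mathbb{K}[V^{m_0}]^{\mathcal{S}_n}$ is separating. Then for all $m \geq m_0$ the expansion $S^{[m]}$ is separating for $\mathbb{K}[V^{m}]^{\mathcal{S}_n}$.
   Context: $\mathcal{S}_n$ is the symmetric group on $\{1,\ldots,n\}$. It acts on $V=\mathbb{K}^n$ by permuting coordinates (the standard representation) and diagonally on $V^m = V\oplus\cdots\oplus V$ ($m$ copies). The coordinate ring of $V^m$ is the polynomial ring $\mathbb{K}[V^m]=\mathbb{K}[x(j)_i \mid i=1,\ldots,n,\ j=1,\ldots,m]$, where $x(j)_i$ sends $(a_1,\ldots,a_m)\in V^m$ to the $i$-th coordinate $(a_j)_i$ of $a_j$. The ring of multisymmetric polynomials $\mathbb{K}[V^m]^{\mathcal{S}_n}$ consists of the polynomials that are invariant under the induced action (simultaneous permutation of the lower indices $i$). Separating set: given a subset $S$ of $\mathbb{K}[V^m]^{\mathcal{S}_n}$, elements $u,v\in V^m$ can be separated by $S$ if there is $f\in S$ with $f(u)\neq f(v)$. The set $S$ is called separating (for $\mathbb{K}[V^m]^{\mathcal{S}_n}$) if any $u,v\in V^m$ that can be separated by $\mathbb{K}[V^m]^{\mathcal{S}_n}$ can also be separated by $S$. Expansion: let $1\le m_0\leq m$. A tuple $\underline{j}=(j_1,\ldots,j_{m_0})\in\mathbb{N}^{m_0}$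 is $m$-admissible if $1\leq j_1<\cdots<j_{m_0}\leq m$. For $m$-admissible $\underline{j}$ and $f\in\mathbb{K}[V^{m_0}]^{\mathcal{S}_n}$, let $f^{(\underline{j})}\in\mathbb{K}[V^m]^{\mathcal{S}_n}$ be the result of substituting $x(l)_i\to x(j_l)_i$ in $f$ for all $1\leq l\leq m_0$, $1\leq i\leq n$. For $S\subset\mathbb{K}[V^{m_0}]^{\mathcal{S}_n}$ the expansion is $S^{[m]}=\{f^{(\underline{j})}\mid f\in S \text{ and } \underline{j}\in\mathbb{N}^{m_0}\text{ is } m\text{-admissible}\}\subset\mathbb{K}[V^m]^{\mathcal{S}_n}$. *)

theory Defs
  imports
    "HOL-Library.Poly_Mapping"
    "HOL-Library.FuncSet"
    "HOL-Combinatorics.Permutations"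
begin

section \<open>Polynomials in the variables \<open>x(j)\<^sub>i\<close>\<close>

text \<open>
  A polynomial is a finitely supported map from monomials (finitely supported exponent maps) to
  coefficients, with the ring structure of \<^theory>\<open>HOL-Library.Poly_Mapping\<close>. Polynomials are
  formal objects: over a finite field they are not determined by the functions they induce.
  The pair \<open>(j, i)\<close> stands for the variable \<open>x(j)\<^sub>i\<close>; both indices count from 1.
\<close>

type_synonym 'k mpoly = "((nat \<times> nat) \<Rightarrow>\<^sub>0 nat) \<Rightarrow>\<^sub>0 'k"

definition mconst :: "'k::comm_ring_1 \<Rightarrow> 'k mpoly" where
  "mconst c = Poly_Mapping.single 0 c"

definition mvar :: "nat \<Rightarrow> nat \<Rightarrow> 'k::comm_ring_1 mpoly" where
  "mvar j i = Poly_Mapping.single (Poly_Mapping.single (j, i) 1) 1"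

definition mvars :: "'k::comm_ring_1 mpoly \<Rightarrow> (nat \<times> nat) set" where
  "mvars f = (\<Union>t\<in>Poly_Mapping.keys f. Poly_Mapping.keys t)"

text \<open>
  The value of \<open>f\<close> in a commutative ring \<open>'r\<close> when \<open>h\<close> is applied to the coefficients and
  \<open>x(j)\<^sub>i\<close> is replaced by \<open>a j i\<close>. It is used with \<open>'r\<close> the field itself (evaluation) and
  with \<open>'r\<close> the polynomial ring (substitution).
\<close>

definition mhom :: "('k::comm_ring_1 \<Rightarrow> 'r::comm_ring_1) \<Rightarrow> (nat \<Rightarrow> nat \<Rightarrow> 'r) \<Rightarrow> 'k mpoly \<Rightarrow> 'r" where
  "mhom h a f =
     (\<Sum>t\<in>Poly_Mapping.keys f. h (Poly_Mapping.lookup f t) *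
        (\<Prod>(j, i)\<in>Poly_Mapping.keys t. a j i ^ Poly_Mapping.lookup t (j, i)))"

definition meval :: "'k::comm_ring_1 mpoly \<Rightarrow> (nat \<Rightarrow> nat \<Rightarrow> 'k) \<Rightarrow> 'k" where
  "meval f a = mhom (\<lambda>c. c) a f"

definition msubst :: "(nat \<Rightarrow> nat \<Rightarrow> 'k::comm_ring_1 mpoly) \<Rightarrow> 'k mpoly \<Rightarrow> 'k mpoly" where
  "msubst \<sigma> f = mhom mconst \<sigma> f"


section \<open>Multisymmetric polynomials\<close>

text \<open>
  A point \<open>a = (a\<^sub>1, \<dots>, a\<^sub>m)\<close> of \<open>V\<^sup>m\<close>, where \<open>V = K\<^sup>n\<close>; the coordinate \<open>(a\<^sub>j)\<^sub>i\<close> is \<open>a j i\<close>.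
\<close>

definition Vpow :: "nat \<Rightarrow> nat \<Rightarrow> (nat \<Rightarrow> nat \<Rightarrow> 'k) set" where
  "Vpow n m = {1..m} \<rightarrow>\<^sub>E ({1..n} \<rightarrow>\<^sub>E UNIV)"

definition coord_ring :: "nat \<Rightarrow> nat \<Rightarrow> 'k::field mpoly set" where
  "coord_ring n m = {f. mvars f \<subseteq> {1..m} \<times> {1..n}}"

text \<open>
  The action is \<open>x(j)\<^sub>i \<mapsto> x(j)\<^sub>k\<close> with \<open>k = \<pi> i\<close>. It is induced by the action on \<open>V\<close> that
  moves the coordinate in position \<open>i\<close> to position \<open>\<pi> i\<close>, through
  \<open>(\<pi> f)(a) = f(\<pi>\<^sup>-\<^sup>1 a)\<close>.
\<close>

definition perm_act :: "(nat \<Rightarrow> nat) \<Rightarrow> 'k::field mpoly \<Rightarrow> 'k mpoly" where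
  "perm_act \<pi> f = msubst (\<lambda>j i. mvar j (\<pi> i)) f"

definition multisym :: "nat \<Rightarrow> nat \<Rightarrow> 'k::field mpoly set" where
  "multisym n m = {f \<in> coord_ring n m. \<forall>\<pi>. \<pi> permutes {1..n} \<longrightarrow> perm_act \<pi> f = f}"


section \<open>Separating sets and expansion\<close>

definition separated_by :: "'k::field mpoly set \<Rightarrow> (nat \<Rightarrow> nat \<Rightarrow> 'k) \<Rightarrow> (nat \<Rightarrow> nat \<Rightarrow> 'k) \<Rightarrow> bool" where
  "separated_by S u v \<longleftrightarrow> (\<exists>f\<in>S. meval f u \<noteq> meval f v)"

definition separating :: "nat \<Rightarrow> nat \<Rightarrow> 'k::field mpoly set \<Rightarrow> bool" where
  "separating n m S \<longleftrightarrow> S \<subseteq> multisym n m \<and>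
     (\<forall>u\<in>Vpow n m. \<forall>v\<in>Vpow n m. separated_by (multisym n m) u v \<longrightarrow> separated_by S u v)"

text \<open>A tuple \<open>(j\<^sub>1, \<dots>, j\<^sub>m\<^sub>0)\<close> is an extensional function on \<open>{1..m0}\<close>.\<close>

definition admissible :: "nat \<Rightarrow> nat \<Rightarrow> (nat \<Rightarrow> nat) \<Rightarrow> bool" where
  "admissible m0 m js \<longleftrightarrow> js \<in> {1..m0} \<rightarrow>\<^sub>E {1..m} \<and> strict_mono_on {1..m0} js"

definition expand_at :: "(nat \<Rightarrow> nat) \<Rightarrow> 'k::field mpoly \<Rightarrow> 'k mpoly" where
  "expand_at js f = msubst (\<lambda>l i. mvar (js l) i) f"

definition expansion :: "nat \<Rightarrow> nat \<Rightarrow> 'k::field mpoly set \<Rightarrow> 'k mpoly set" where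
  "expansion m0 m S = {expand_at js f | f js. f \<in> S \<and> admissible m0 m js}"

end

theory Submission
  imports Defs "HOL-Library.Infinite_Set"
begin

text \<open>
  A point of \<open>V\<^sup>m\<close> is a matrix with \<open>m\<close> rows and \<open>n\<close> columns, and the symmetric group permutes
  the columns. So the orbit of a point is the multiset of its \<open>n\<close> columns, which are vectors in
  \<open>K\<^sup>m\<close>. The proof has an algebraic and a combinatorial half.

  Algebraically, multisymmetric polynomials over any field separate two points exactly if the
  multisets of columns differ (\<open>separated_by_multisym_iff\<close>). Counting a column \<open>w\<close> by a power sum
  would only give its multiplicity modulo the characteristic. Instead, a polynomial that is nonzero
  at \<open>w\<close> and vanishes at all other columns involved is plugged into an elementary symmetric
  polynomial whose degree is the larger of the two multiplicities; this is nonzero at the point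
  with the larger multiplicity and zero at the other one.

  Since \<open>f\<^sup>(\<^sup>j\<^sup>)\<close> evaluates \<open>f\<close> at the rows \<open>j\<close> of a point, the first half says that two points
  that \<open>S\<^sup>[\<^sup>m\<^sup>]\<close> does not separate have equal column multisets after projection to any \<open>m0\<close> rows. It
  remains to show that the full column multisets agree (\<open>columns_eq_of_small_projections\<close>).
  The number of rows may be increased one at a time, so let \<open>U\<close> and \<open>V\<close> be multisets of
  \<open>n\<close> vectors in \<open>K\<^sup>d\<close>, with \<open>d > m0\<close>, that agree after forgetting any one coordinate.
  The difference of their multiplicity functions then has sum zero on every line parallel to an
  axis. Such a function is zero or has at least \<open>2\<^sup>d\<close> points in its support, because at
  least two of its slices are nonzero and the slices have the same property in dimension \<open>d - 1\<close>
  (\<open>zero_line_sums_imp_large_support\<close>). The support here has at most \<open>2 n\<close> points, and the bound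
  on \<open>m0\<close> gives \<open>2 n < 2\<^sup>d\<close>. So the difference is zero.
\<close>

section \<open>Evaluation and substitution are ring homomorphisms\<close>

text \<open>
  Both coefficient maps (the identity and \<open>mconst\<close>) and the resulting evaluation and substitution
  maps are instances. That the latter are instances again is what makes them compose.
\<close>
locale unital_ring_hom =
  fixes h :: "'a::comm_ring_1 \<Rightarrow> 'b::comm_ring_1"
  assumes hom_add: "h (x + y) = h x + h y"
    and hom_mult: "h (x * y) = h x * h y"
    and hom_one: "h 1 = 1"
begin

lemma hom_zero: "h 0 = 0"
  using hom_add[of 0 0] by simp

lemma hom_sum: "h (sum f A) = (\<Sum>x\<in>A. h (f x))"
  by (induction A rule: infinite_finite_induct) (simp_all add: hom_zero hom_add)

lemma hom_prod: "h (prod f A) = (\<Prod>x\<in>A. h (f x))"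
  by (induction A rule: infinite_finite_induct) (simp_all add: hom_one hom_mult)

lemma hom_power: "h (x ^ k) = h x ^ k"
  by (induction k) (simp_all add: hom_one hom_mult)

end

definition monomial_value ::
    "(nat \<Rightarrow> nat \<Rightarrow> 'r::comm_ring_1) \<Rightarrow> ((nat \<times> nat) \<Rightarrow>\<^sub>0 nat) \<Rightarrow> 'r" where
  "monomial_value a t =
     (\<Prod>(j, i)\<in>Poly_Mapping.keys t. a j i ^ Poly_Mapping.lookup t (j, i))"

lemma monomial_value_superset:
  assumes "finite A" "Poly_Mapping.keys t \<subseteq> A"
  shows "monomial_value a t = (\<Prod>(j, i)\<in>A. a j i ^ Poly_Mapping.lookup t (j, i))"
  unfolding monomial_value_def
  using assms by (intro prod.mono_neutral_left) (auto simp: in_keys_iff)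

lemma monomial_value_add:
  "monomial_value a (s + t) = monomial_value a s * monomial_value a t"
proof -
  let ?A = "Poly_Mapping.keys s \<union> Poly_Mapping.keys t"
  have "monomial_value a (s + t) = (\<Prod>(j, i)\<in>?A. a j i ^ Poly_Mapping.lookup (s + t) (j, i))"
    by (rule monomial_value_superset) (simp_all add: keys_add)
  also have "\<dots> = (\<Prod>(j, i)\<in>?A. a j i ^ Poly_Mapping.lookup s (j, i)) *
                    (\<Prod>(j, i)\<in>?A. a j i ^ Poly_Mapping.lookup t (j, i))"
    by (simp add: prod.distrib[symmetric] case_prod_beta lookup_add power_add)
  also have "\<dots> = monomial_value a s * monomial_value a t"
    by (simp add: monomial_value_superset[of ?A])
  finally show ?thesis .
qed

lemma mhom_alt:
  "mhom h a f =
     (\<Sum>t\<in>Poly_Mapping.keys f. h (Poly_Mapping.lookup f t) * monomial_value a t)"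
  by (simp add: mhom_def monomial_value_def)

text \<open>
  Unlike \<open>update_induct\<close>, this rule builds a polynomial by addition, which a homomorphism respects.
\<close>
lemma poly_mapping_add_single_induct:
  fixes P :: "('a \<Rightarrow>\<^sub>0 'b::comm_monoid_add) \<Rightarrow> bool"
  assumes "P 0" "\<And>f t c. P f \<Longrightarrow> P (Poly_Mapping.single t c + f)"
  shows "P f"
proof (induction f rule: update_induct)
  case const
  then show ?case by (rule assms(1))
next
  case (update f a b)
  have "Poly_Mapping.update a b f = Poly_Mapping.single a b + f"
    using update(1) 
    by (intro poly_mapping_eqI) (auto simp: lookup_update lookup_add lookup_single in_keys_iff)
  then show ?case using assms(2)[OF update(3)] by simp
qed

context unital_ring_hom
begin

lemma mhom_superset:
  assumes "finite T" "Poly_Mapping.keys f \<subseteq> T"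
  shows "mhom h a f = (\<Sum>t\<in>T. h (Poly_Mapping.lookup f t) * monomial_value a t)"
  unfolding mhom_alt
  using assms by (intro sum.mono_neutral_left) (auto simp: in_keys_iff hom_zero)

lemma mhom_add: "mhom h a (f + g) = mhom h a f + mhom h a g"
proof -
  let ?T = "Poly_Mapping.keys f \<union> Poly_Mapping.keys g"
  have "mhom h a (f + g) = (\<Sum>t\<in>?T. h (Poly_Mapping.lookup (f + g) t) * monomial_value a t)"
    by (rule mhom_superset) (simp_all add: keys_add)
  also have "\<dots> = mhom h a f + mhom h a g"
    by (simp add: mhom_superset[of ?T] lookup_add hom_add distrib_right sum.distrib)
  finally show ?thesis .
qed

lemma mhom_single: "mhom h a (Poly_Mapping.single t c) = h c * monomial_value a t"
  by (simp add: mhom_alt hom_zero)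

text \<open>By additivity in both factors, it suffices to multiply two terms.\<close>
lemma mhom_mult: "mhom h a (f * g) = mhom h a f * mhom h a g"
proof (induction f rule: poly_mapping_add_single_induct)
  case 1
  then show ?case by (simp add: mhom_alt)
next
  case (2 f t c)
  have "mhom h a (Poly_Mapping.single t c * g) = mhom h a (Poly_Mapping.single t c) * mhom h a g"
  proof (induction g rule: poly_mapping_add_single_induct)
    case 1
    then show ?case by (simp add: mhom_alt)
  next
    case (2 g s d)
    then show ?case
      by (simp add: distrib_left mhom_add mhom_single mult_single hom_mult monomial_value_add
          mult_ac)
  qed
  with 2 show ?case by (simp add: distrib_right mhom_add)
qed

lemma mhom_is_hom: "unital_ring_hom (mhom h a)"
proof
  have "mhom h a (Poly_Mapping.single 0 1) = 1"
    by (simp only: mhom_single) (simp add: hom_one monomial_value_def)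
  then show "mhom h a 1 = 1" by simp
qed (rule mhom_add mhom_mult)+

lemma mhom_mvar: "mhom h a (mvar j i) = a j i"
  by (simp add: mvar_def mhom_single hom_one monomial_value_def)

lemma mhom_mconst: "mhom h a (mconst c) = h c"
  by (simp add: mconst_def mhom_single monomial_value_def)

text \<open>
  This yields all composition laws below: take for \<open>h\<close> an evaluation or a substitution.
\<close>
lemma hom_mhom: "h (mhom g a f) = mhom (\<lambda>c. h (g c)) (\<lambda>j i. h (a j i)) f"
  by (simp add: mhom_def hom_sum hom_mult hom_prod hom_power case_prod_beta)

end

lemma mhom_cong:
  assumes "\<And>j i. (j, i) \<in> mvars f \<Longrightarrow> a j i = b j i"
  shows "mhom h a f = mhom h b f"
proof -
  have "monomial_value a t = monomial_value b t" if "t \<in> Poly_Mapping.keys f" for t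
    unfolding monomial_value_def
  proof (intro prod.cong refl, clarify)
    fix j i assume "(j, i) \<in> Poly_Mapping.keys t"
    with that have "(j, i) \<in> mvars f" by (auto simp: mvars_def)
    then show "a j i ^ Poly_Mapping.lookup t (j, i) = b j i ^ Poly_Mapping.lookup t (j, i)"
      by (simp add: assms)
  qed
  then show ?thesis by (simp add: mhom_alt)
qed

interpretation mconst: unital_ring_hom mconst
  by unfold_locales (simp_all add: mconst_def single_add mult_single)

lemma unital_ring_hom_id: "unital_ring_hom (\<lambda>c. c)"
  by unfold_locales simp_all

interpretation meval: unital_ring_hom "\<lambda>f. meval f a"
  unfolding meval_def by (rule unital_ring_hom.mhom_is_hom[OF unital_ring_hom_id])

interpretation msubst: unital_ring_hom "msubst \<sigma>"
  unfolding msubst_def[abs_def] by (rule mconst.mhom_is_hom)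

lemma meval_mvar: "meval (mvar j i) a = a j i"
  and meval_mconst: "meval (mconst c) a = c"
  unfolding meval_def
  by (rule unital_ring_hom.mhom_mvar unital_ring_hom.mhom_mconst; rule unital_ring_hom_id)+

lemma msubst_mvar: "msubst \<sigma> (mvar j i) = \<sigma> j i"
  and msubst_mconst: "msubst \<sigma> (mconst c) = mconst c"
  unfolding msubst_def by (rule mconst.mhom_mvar mconst.mhom_mconst)+

lemma meval_msubst: "meval (msubst \<sigma> f) a = meval f (\<lambda>j i. meval (\<sigma> j i) a)"
  by (simp add: msubst_def meval.hom_mhom meval_mconst) (simp add: meval_def)

lemma msubst_msubst: "msubst \<tau> (msubst \<sigma> f) = msubst (\<lambda>j i. msubst \<tau> (\<sigma> j i)) f"
  by (subst (2) msubst_def, simp add: msubst.hom_mhom msubst_mconst)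
     (simp add: msubst_def[of _ f])

lemma meval_perm_act: "meval (perm_act \<pi> f) a = meval f (\<lambda>j i. a j (\<pi> i))"
  by (simp add: perm_act_def meval_msubst meval_mvar)

lemma meval_expand_at: "meval (expand_at js f) a = meval f (\<lambda>l i. a (js l) i)"
  by (simp add: expand_at_def meval_msubst meval_mvar)

section \<open>Closure properties of the coordinate ring\<close>

lemma coord_ring_add: "f \<in> coord_ring n m \<Longrightarrow> g \<in> coord_ring n m \<Longrightarrow> f + g \<in> coord_ring n m"
  using keys_add[of f g] by (fastforce simp: coord_ring_def mvars_def)

lemma coord_ring_mult:
  assumes "f \<in> coord_ring n m" "g \<in> coord_ring n m"
  shows "f * g \<in> coord_ring n m"
proof -
  have "mvars (f * g) \<subseteq> mvars f \<union> mvars g"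
    using keys_mult[of f g] keys_add by (fastforce simp: mvars_def)
  with assms show ?thesis by (auto simp: coord_ring_def)
qed

lemma coord_ring_mconst: "mconst c \<in> coord_ring n m"
  by (auto simp: coord_ring_def mvars_def mconst_def split: if_splits)

lemma coord_ring_mvar: "j \<in> {1..m} \<Longrightarrow> i \<in> {1..n} \<Longrightarrow> mvar j i \<in> coord_ring n m"
  by (auto simp: coord_ring_def mvars_def mvar_def split: if_splits)

lemma coord_ring_sum: "(\<And>x. x \<in> A \<Longrightarrow> f x \<in> coord_ring n m) \<Longrightarrow> sum f A \<in> coord_ring n m"
  using coord_ring_mconst[of 0]
  by (induction A rule: infinite_finite_induct) (auto simp: mconst.hom_zero coord_ring_add)

lemma coord_ring_prod: "(\<And>x. x \<in> A \<Longrightarrow> f x \<in> coord_ring n m) \<Longrightarrow> prod f A \<in> coord_ring n m"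
  using coord_ring_mconst[of 1]
  by (induction A rule: infinite_finite_induct) (auto simp: mconst.hom_one coord_ring_mult)

lemma coord_ring_power: "f \<in> coord_ring n m \<Longrightarrow> f ^ k \<in> coord_ring n m"
  using coord_ring_prod[of "{..<k}" "\<lambda>_. f"] by simp

lemma coord_ring_msubst:
  assumes "\<And>j i. (j, i) \<in> mvars f \<Longrightarrow> \<sigma> j i \<in> coord_ring n m"
  shows "msubst \<sigma> f \<in> coord_ring n m"
  unfolding msubst_def mhom_def using assms
  by (intro coord_ring_sum coord_ring_mult coord_ring_mconst coord_ring_prod)
     (auto simp: mvars_def intro!: coord_ring_power)

text \<open>
  Expansion renames the upper indices and the group acts on the lower ones, so the two commute.
\<close>
lemma expand_at_multisym:
  assumes "f \<in> multisym n m0" "js \<in> {1..m0} \<rightarrow> {1..m}"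
  shows "expand_at js f \<in> multisym n m"
proof -
  have "expand_at js f \<in> coord_ring n m"
    unfolding expand_at_def using assms
    by (intro coord_ring_msubst coord_ring_mvar) (auto simp: multisym_def coord_ring_def)
  moreover have "perm_act \<pi> (expand_at js f) = expand_at js f" if "\<pi> permutes {1..n}" for \<pi>
  proof -
    have "perm_act \<pi> (expand_at js f) = expand_at js (perm_act \<pi> f)"
      by (simp add: perm_act_def expand_at_def msubst_msubst msubst_mvar)
    with that assms(1) show ?thesis by (simp add: multisym_def)
  qed
  ultimately show ?thesis by (simp add: multisym_def)
qed

section \<open>Multisymmetric polynomials separate multisets of columns\<close>

text \<open>
  The columns of the rows \<open>J\<close> only. Each column is made undefined outside of \<open>J\<close>, so that for
  \<open>J = {1..m}\<close> equality of these multisets means that two points of \<open>V\<^sup>m\<close> lie in the same orbit.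
\<close>
definition columns :: "nat \<Rightarrow> nat set \<Rightarrow> (nat \<Rightarrow> nat \<Rightarrow> 'k) \<Rightarrow> (nat \<Rightarrow> 'k) multiset" where
  "columns n J u = image_mset (\<lambda>i. restrict (\<lambda>j. u j i) J) (mset_set {1..n})"

lemma count_columns: "count (columns n J u) w = card {i \<in> {1..n}. restrict (\<lambda>j. u j i) J = w}"
  by (simp add: columns_def count_image_mset vimage_def Int_def conj_commute)

lemma size_columns: "size (columns n J u) = n"
  by (simp add: columns_def)

lemma columns_extensional: "x \<in># columns n J u \<Longrightarrow> x \<in> extensional J"
  by (auto simp: columns_def)

lemma image_restrict_columns:
  "J' \<subseteq> J \<Longrightarrow> image_mset (\<lambda>y. restrict y J') (columns n J u) = columns n J' u"
  by (auto simp: columns_def multiset.map_comp comp_def restrict_restrict Int_absorb1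
      intro!: image_mset_cong)

text \<open>Equal multisets of columns differ by a permutation, under which \<open>f\<close> is invariant.\<close>
lemma meval_multisym_cong:
  assumes f: "f \<in> multisym n m" and eq: "columns n {1..m} u = columns n {1..m} v"
  shows "meval f u = meval f v"
proof -
  obtain \<pi> where \<pi>: "\<pi> permutes {1..n}"
    and uv: "\<And>i. i \<in> {1..n} \<Longrightarrow>
      restrict (\<lambda>j. u j i) {1..m} = restrict (\<lambda>j. v j (\<pi> i)) {1..m}"
    using eq unfolding columns_def
    by (elim image_mset_eq_implies_permutes[rotated]) auto
  have "u j i = v j (\<pi> i)" if "(j, i) \<in> mvars f" for j i
  proof -
    have "j \<in> {1..m}" "i \<in> {1..n}"
      using that f by (auto simp: multisym_def coord_ring_def)
    then show ?thesis using fun_cong[OF uv, of i j] by simp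
  qed
  then have "meval f u = meval f (\<lambda>j i. v j (\<pi> i))"
    unfolding meval_def by (rule mhom_cong)
  also have "\<dots> = meval (perm_act \<pi> f) v"
    by (simp add: meval_perm_act)
  also have "perm_act \<pi> f = f"
    using f \<pi> by (simp add: multisym_def)
  finally show ?thesis .
qed

text \<open>
  The elementary symmetric polynomial of degree \<open>b\<close> at a point with coordinates in \<open>{0, c}\<close>: only
  products over subsets of the support \<open>A\<close> survive. For \<open>card A = b\<close> the binomial coefficient is 1
  and for \<open>card A < b\<close> it is 0, so these two cases are told apart in every characteristic.
\<close>
lemma esym_two_valued:
  fixes c :: "'k::comm_ring_1"
  assumes "finite I" "A \<subseteq> I"
  shows "(\<Sum>B | B \<subseteq> I \<and> card B = b. \<Prod>i\<in>B. if i \<in> A then c else 0) =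
    of_nat (card A choose b) * c ^ b"
proof -
  have fin: "finite {B. B \<subseteq> I \<and> card B = b}"
    using assms(1) by (auto intro: finite_subset[of _ "Pow I"])
  have "(\<Sum>B | B \<subseteq> I \<and> card B = b. \<Prod>i\<in>B. if i \<in> A then c else 0) =
        (\<Sum>B | B \<subseteq> A \<and> card B = b. \<Prod>i\<in>B. if i \<in> A then c else 0)"
  proof (rule sum.mono_neutral_right[OF fin])
    show "\<forall>B\<in>{B. B \<subseteq> I \<and> card B = b} - {B. B \<subseteq> A \<and> card B = b}.
        (\<Prod>i\<in>B. if i \<in> A then c else 0) = 0"
    proof
      fix B assume "B \<in> {B. B \<subseteq> I \<and> card B = b} - {B. B \<subseteq> A \<and> card B = b}"
      then obtain i where "finite B" "i \<in> B" "i \<notin> A"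
        using assms(1) by (auto dest: finite_subset)
      then show "(\<Prod>i\<in>B. if i \<in> A then c else 0) = 0"
        by (auto simp: prod.remove[of B i])
    qed
  qed (use assms(2) in auto)
  also have "\<dots> = (\<Sum>B | B \<subseteq> A \<and> card B = b. c ^ b)"
  proof (rule sum.cong[OF refl])
    fix B assume "B \<in> {B. B \<subseteq> A \<and> card B = b}"
    then have "B \<subseteq> A" "card B = b" by auto
    then have "(\<Prod>i\<in>B. if i \<in> A then c else 0) = (\<Prod>i\<in>B. c)"
      by (intro prod.cong) auto
    with \<open>card B = b\<close> show "(\<Prod>i\<in>B. if i \<in> A then c else 0) = c ^ b" by simp
  qed
  also have "\<dots> = of_nat (card A choose b) * c ^ b"
    using n_subsets[of A b] finite_subset[OF assms(2,1)] by simp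
  finally show ?thesis .
qed

text \<open>Meaningful for \<open>z \<noteq> w\<close> only; for \<open>z = w\<close> it is an arbitrary index.\<close>
definition differing_coord :: "(nat \<Rightarrow> 'k) \<Rightarrow> (nat \<Rightarrow> 'k) \<Rightarrow> nat" where
  "differing_coord w z = (SOME j. z j \<noteq> w j)"

text \<open>
  A polynomial in the \<open>i\<close>-th column that vanishes at the elements of \<open>Z\<close> other than \<open>w\<close>, but not at
  \<open>w\<close>: for each \<open>z\<close> one linear factor, in a row where \<open>z\<close> and \<open>w\<close> differ.
\<close>
definition column_detector ::
    "(nat \<Rightarrow> 'k::field) set \<Rightarrow> (nat \<Rightarrow> 'k) \<Rightarrow> nat \<Rightarrow> 'k mpoly" where
  "column_detector Z w i = (\<Prod>z\<in>Z - {w}.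
     mvar (differing_coord w z) i + mconst (- z (differing_coord w z)))"

text \<open>The elementary symmetric polynomial of degree \<open>b\<close> in the \<open>n\<close> column detectors.\<close>
definition column_counter ::
    "nat \<Rightarrow> (nat \<Rightarrow> 'k::field) set \<Rightarrow> (nat \<Rightarrow> 'k) \<Rightarrow> nat \<Rightarrow> 'k mpoly" where
  "column_counter n Z w b =
     (\<Sum>B | B \<subseteq> {1..n} \<and> card B = b. \<Prod>i\<in>B. column_detector Z w i)"

lemma differing_coord: "z \<noteq> w \<Longrightarrow> z (differing_coord w z) \<noteq> w (differing_coord w z)"
  unfolding differing_coord_def by (rule someI_ex) auto

lemma differing_coord_mem:
  assumes "z \<noteq> w" "z \<in> extensional J" "w \<in> extensional J"
  shows "differing_coord w z \<in> J"
  using differing_coord[OF assms(1)] assms(2,3) by (metis extensional_arb)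

text \<open>
  A permutation of the columns permutes the detectors, since they differ only in the column that
  they look at.
\<close>
lemma column_counter_multisym:
  assumes "Z \<subseteq> extensional {1..m}" "w \<in> extensional {1..m}"
  shows "column_counter n Z w b \<in> multisym n m"
proof -
  have "column_counter n Z w b \<in> coord_ring n m"
    unfolding column_counter_def column_detector_def
    using assms
    by (intro coord_ring_sum coord_ring_prod coord_ring_add coord_ring_mvar coord_ring_mconst
          differing_coord_mem) auto
  moreover have "perm_act \<pi> (column_counter n Z w b) = column_counter n Z w b"
    if \<pi>: "\<pi> permutes {1..n}" for \<pi>
  proof -
    have "perm_act \<pi> (column_counter n Z w b) =
        (\<Sum>B | B \<subseteq> {1..n} \<and> card B = b. \<Prod>i\<in>B. column_detector Z w (\<pi> i))"
      by (simp add: perm_act_def column_counter_def column_detector_def msubst.hom_sum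
          msubst.hom_prod msubst.hom_add msubst_mvar msubst_mconst)
    also have "\<dots> = (\<Sum>B | B \<subseteq> {1..n} \<and> card B = b. \<Prod>i\<in>\<pi> ` B. column_detector Z w i)"
      using permutes_inj[OF \<pi>] by (simp add: prod.reindex inj_on_subset)
    also have "\<dots> = column_counter n Z w b"
      unfolding column_counter_def
    proof (rule sum.reindex_bij_witness[where i = "\<lambda>B. inv \<pi> ` B" and j = "\<lambda>B. \<pi> ` B"])
      fix B assume B: "B \<in> {B. B \<subseteq> {1..n} \<and> card B = b}"
      show "inv \<pi> ` \<pi> ` B = B" "\<pi> ` inv \<pi> ` B = B"
        using permutes_inverses[OF \<pi>] by (auto simp: image_image)
      have "\<rho> ` B \<in> {B. B \<subseteq> {1..n} \<and> card B = b}" if "\<rho> permutes {1..n}" for \<rho>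
        using B image_mono[of B "{1..n}" \<rho>] permutes_image[OF that]
          card_image[OF inj_on_subset[OF permutes_inj[OF that]], of B] by simp
      then show "\<pi> ` B \<in> {B. B \<subseteq> {1..n} \<and> card B = b}"
        and "inv \<pi> ` B \<in> {B. B \<subseteq> {1..n} \<and> card B = b}"
        using \<pi> permutes_inv[OF \<pi>] by blast+
    qed simp
    finally show ?thesis .
  qed
  ultimately show ?thesis by (simp add: multisym_def)
qed

text \<open>
  As long as all columns of \<open>a\<close> lie in \<open>Z\<close>, each detector takes one of two values: zero, or a
  nonzero constant exactly at the columns equal to \<open>w\<close>.
\<close>
lemma meval_column_counter:
  assumes "finite Z" "Z \<subseteq> extensional J" "w \<in> extensional J" "set_mset (columns n J a) \<subseteq> Z"
  shows "meval (column_counter n Z w b) a =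
    of_nat (count (columns n J a) w choose b) *
    (\<Prod>z\<in>Z - {w}. w (differing_coord w z) - z (differing_coord w z)) ^ b"
proof -
  let ?c = "\<Prod>z\<in>Z - {w}. w (differing_coord w z) - z (differing_coord w z)"
  let ?A = "{i \<in> {1..n}. restrict (\<lambda>j. a j i) J = w}"
  have detect: "meval (column_detector Z w i) a = (if i \<in> ?A then ?c else 0)"
    if i: "i \<in> {1..n}" for i
  proof -
    let ?y = "restrict (\<lambda>j. a j i) J"
    have "meval (column_detector Z w i) a =
        (\<Prod>z\<in>Z - {w}. a (differing_coord w z) i - z (differing_coord w z))"
      by (simp add: column_detector_def meval.hom_prod meval.hom_add meval_mvar meval_mconst)
    also have "\<dots> = (\<Prod>z\<in>Z - {w}. ?y (differing_coord w z) - z (differing_coord w z))"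
      using assms(2,3) by (intro prod.cong refl) (auto simp: differing_coord_mem subset_iff)
    also have "\<dots> = (if i \<in> ?A then ?c else 0)"
    proof (cases "?y = w")
      case False
      have "?y \<in> Z" using assms(4) i by (auto simp: columns_def)
      then show ?thesis using False assms(1) by (auto intro!: prod_zero bexI[of _ ?y])
    qed (use i in simp)
    finally show ?thesis .
  qed
  have "meval (column_counter n Z w b) a =
      (\<Sum>B | B \<subseteq> {1..n} \<and> card B = b. \<Prod>i\<in>B. if i \<in> ?A then ?c else 0)"
    unfolding column_counter_def meval.hom_sum meval.hom_prod
    by (intro sum.cong prod.cong refl detect) auto
  also have "\<dots> = of_nat (count (columns n J a) w choose b) * ?c ^ b"
    unfolding count_columns by (rule esym_two_valued) auto
  finally show ?thesis .
qed

text \<open>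
  The degree of the separating polynomial is the larger multiplicity: then the binomial coefficient
  in \<open>meval_column_counter\<close> is 0 at \<open>u\<close> and 1 at \<open>v\<close>.
\<close>
lemma separated_by_multisym_if_count_less:
  fixes u v :: "nat \<Rightarrow> nat \<Rightarrow> 'k::field"
  assumes "count (columns n {1..m} u) w < count (columns n {1..m} v) w"
  shows "separated_by (multisym n m) u v"
proof -
  let ?Z = "set_mset (columns n {1..m} u) \<union> set_mset (columns n {1..m} v)"
  let ?b = "count (columns n {1..m} v) w"
  have ext: "?Z \<subseteq> extensional {1..m}" by (auto dest: columns_extensional)
  have "w \<in># columns n {1..m} v" using assms by (simp flip: count_greater_zero_iff)
  then have w: "w \<in> extensional {1..m}" by (rule columns_extensional)
  let ?f = "column_counter n ?Z w ?b"
  let ?c = "\<Prod>z\<in>?Z - {w}. w (differing_coord w z) - z (differing_coord w z)"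
  have val: "meval ?f a = of_nat (count (columns n {1..m} a) w choose ?b) * ?c ^ ?b"
    if "set_mset (columns n {1..m} a) \<subseteq> ?Z" for a
    by (rule meval_column_counter[OF _ ext w that]) simp
  have "meval ?f u = 0"
    using val[of u] assms by (simp add: binomial_eq_0)
  moreover have "meval ?f v \<noteq> 0"
  proof -
    have "w (differing_coord w z) - z (differing_coord w z) \<noteq> 0" if "z \<in> ?Z - {w}" for z
      using differing_coord[of z w] that by simp
    then have "?c \<noteq> 0" by (simp only: prod_zero_iff finite_Diff finite_Un finite_set_mset) blast
    then show ?thesis using val[of v] by (simp del: prod_zero_iff)
  qed
  ultimately show ?thesis
    using column_counter_multisym[OF ext w, of n ?b] unfolding separated_by_def by metis
qed

lemma separated_by_multisym_iff:
  "separated_by (multisym n m) u v \<longleftrightarrow> columns n {1..m} u \<noteq> columns n {1..m} v"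
proof
  show "separated_by (multisym n m) u v \<Longrightarrow> columns n {1..m} u \<noteq> columns n {1..m} v"
    using meval_multisym_cong unfolding separated_by_def by blast
next
  assume "columns n {1..m} u \<noteq> columns n {1..m} v"
  then obtain w where "count (columns n {1..m} u) w \<noteq> count (columns n {1..m} v) w"
    by (auto simp: multiset_eq_iff)
  then have "separated_by (multisym n m) u v \<or> separated_by (multisym n m) v u"
    using separated_by_multisym_if_count_less by (metis linorder_neqE_nat)
  moreover have "separated_by (multisym n m) v u = separated_by (multisym n m) u v"
    unfolding separated_by_def by (intro bex_cong) auto
  ultimately show "separated_by (multisym n m) u v" by blast
qed

section \<open>Multisets of vectors determined by their projections\<close>

text \<open>
  The support of a nonzero function whose sums over all lines in the directions of \<open>J\<close> are zero is
  at least as large as the vertex set of a cube of dimension \<open>card J\<close>. Given a direction \<open>j\<close>, a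
  line in this direction through one point of the support contains a second one. The slices
  orthogonal to \<open>j\<close> through these two points are disjoint, and the induction hypothesis applies to
  each of them.
\<close>
lemma zero_line_sums_imp_large_support:
  fixes D :: "('a \<Rightarrow> 'b) \<Rightarrow> 'c::comm_monoid_add"
  assumes "finite J" "finite {x. D x \<noteq> 0}" "D x0 \<noteq> 0"
    and "\<And>j x. j \<in> J \<Longrightarrow> (\<Sum>y | D y \<noteq> 0 \<and> (\<forall>i. i \<noteq> j \<longrightarrow> y i = x i). D y) = 0"
  shows "2 ^ card J \<le> card {x. D x \<noteq> 0}"
  using assms
proof (induction J arbitrary: D x0 rule: finite_induct)
  case empty
  then have "{x. D x \<noteq> 0} \<noteq> {}" by auto
  with empty show ?case by (simp add: Suc_le_eq card_gt_0_iff)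
next
  case (insert j J)
  have slice: "2 ^ card J \<le> card {y. D y \<noteq> 0 \<and> y j = x j}" if x: "D x \<noteq> 0" for x
  proof -
    \<comment> \<open>the restriction of \<open>D\<close> to the slice through \<open>x\<close>, extended by zero\<close>
    define E where "E = (\<lambda>y. if y j = x j then D y else 0)"
    have E: "{y. E y \<noteq> 0} = {y. D y \<noteq> 0 \<and> y j = x j}"
      by (auto simp: E_def)
    have "(\<Sum>y | E y \<noteq> 0 \<and> (\<forall>i. i \<noteq> k \<longrightarrow> y i = z i). E y) = 0" if k: "k \<in> J" for k z
    proof (cases "z j = x j")
      case True
      have "k \<noteq> j" using k insert.hyps by auto
      then have "(\<Sum>y | E y \<noteq> 0 \<and> (\<forall>i. i \<noteq> k \<longrightarrow> y i = z i). E y) =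
          (\<Sum>y | D y \<noteq> 0 \<and> (\<forall>i. i \<noteq> k \<longrightarrow> y i = z i). D y)"
        using True by (intro sum.cong) (auto simp: E_def)
      with insert.prems(3)[of k z] k show ?thesis by simp
    next
      case False
      have "k \<noteq> j" using k insert.hyps by auto
      then have "{y. E y \<noteq> 0 \<and> (\<forall>i. i \<noteq> k \<longrightarrow> y i = z i)} = {}"
        using False by (auto simp: E_def)
      then show ?thesis by (simp only: sum.empty)
    qed
    moreover have "finite {y. E y \<noteq> 0}"
      unfolding E by (rule finite_subset[OF _ insert.prems(1)]) auto
    moreover have "E x \<noteq> 0" using x by (simp add: E_def)
    ultimately have "2 ^ card J \<le> card {y. E y \<noteq> 0}" by (intro insert.IH)
    then show ?thesis by (simp only: E)
  qed
  obtain x1 where x1: "D x1 \<noteq> 0" "x1 j \<noteq> x0 j"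
  proof (rule ccontr)
    assume "\<not> thesis"
    with that have no: "D y \<noteq> 0 \<Longrightarrow> y j = x0 j" for y by blast
    have "y = x0" if "D y \<noteq> 0" "\<forall>i. i \<noteq> j \<longrightarrow> y i = x0 i" for y
      using no[OF that(1)] that(2) by (metis ext)
    then have "{y. D y \<noteq> 0 \<and> (\<forall>i. i \<noteq> j \<longrightarrow> y i = x0 i)} = {x0}"
      using insert.prems(2) by auto
    with insert.prems(3)[of j x0] insert.prems(2) show False by simp
  qed
  let ?S = "\<lambda>x. {y. D y \<noteq> 0 \<and> y j = x j}"
  have fin: "finite (?S x)" for x
    by (rule finite_subset[OF _ insert.prems(1)]) auto
  have "2 ^ card (insert j J) \<le> card (?S x0) + card (?S x1)"
    using slice[OF insert.prems(2)] slice[OF x1(1)] insert.hyps by simp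
  also have "\<dots> = card (?S x0 \<union> ?S x1)"
    using x1(2) by (intro card_Un_disjoint[symmetric] fin) auto
  also have "\<dots> \<le> card {x. D x \<noteq> 0}"
    by (rule card_mono[OF insert.prems(1)]) auto
  finally show ?case .
qed

text \<open>
  The multiplicity of a point in the projection that forgets the coordinate \<open>j\<close> is the sum of the
  multiplicities over a line in direction \<open>j\<close>. So the difference of the multiplicity functions of
  \<open>U\<close> and \<open>V\<close> has zero line sums, and the hypothesis on the sizes makes its support too small.
\<close>
lemma mset_eq_of_facet_projections_eq:
  fixes U V :: "('a \<Rightarrow> 'b) multiset"
  assumes J: "finite J" and ext: "set_mset (U + V) \<subseteq> extensional J"
    and proj: "\<And>j. j \<in> J \<Longrightarrow> image_mset (\<lambda>y. restrict y (J - {j})) U =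
      image_mset (\<lambda>y. restrict y (J - {j})) V"
    and size: "size U + size V < 2 ^ card J"
  shows "U = V"
proof (rule ccontr)
  assume "U \<noteq> V"
  define D where "D = (\<lambda>x. int (count U x) - int (count V x))"
  obtain x0 where x0: "D x0 \<noteq> 0"
    using \<open>U \<noteq> V\<close> by (auto simp: D_def multiset_eq_iff)
  have supp: "{x. D x \<noteq> 0} \<subseteq> set_mset (U + V)"
  proof (rule subsetI, rule ccontr)
    fix x assume "x \<in> {x. D x \<noteq> 0}" "x \<notin> set_mset (U + V)"
    moreover from this(2) have "count U x = 0" "count V x = 0"
      by (simp_all add: count_eq_zero_iff)
    ultimately show False by (simp add: D_def)
  qed
  have "(\<Sum>y | D y \<noteq> 0 \<and> (\<forall>i. i \<noteq> j \<longrightarrow> y i = x i). D y) = 0" if j: "j \<in> J" for j x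
  proof -
    let ?L = "{y \<in> set_mset (U + V). restrict y (J - {j}) = x(j := undefined)}"
    \<comment> \<open>forgetting the coordinate \<open>j\<close> of an extensional \<open>y\<close> sets it to \<open>undefined\<close>, so a line in
      direction \<open>j\<close> is a fibre of the projection\<close>
    have line: "(\<forall>i. i \<noteq> j \<longrightarrow> y i = x i) \<longleftrightarrow> restrict y (J - {j}) = x(j := undefined)"
      if "y \<in> set_mset (U + V)" for y
    proof -
      have "restrict y (J - {j}) = y(j := undefined)"
        using that ext by (intro HOL.ext) (auto simp: restrict_def extensional_def)
      then show ?thesis by (auto simp: fun_eq_iff)
    qed
    have count: "(\<Sum>y\<in>?L. count W y) =
        count (image_mset (\<lambda>y. restrict y (J - {j})) W) (x(j := undefined))"
      if "set_mset W \<subseteq> set_mset (U + V)" for W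
      unfolding count_image_mset'
    proof (rule sum.mono_neutral_right)
      show "\<forall>y\<in>?L - {y. y \<in># W \<and> x(j := undefined) = restrict y (J - {j})}. count W y = 0"
        by (auto simp: count_eq_zero_iff)
    qed (use that in auto)
    have "(\<Sum>y | D y \<noteq> 0 \<and> (\<forall>i. i \<noteq> j \<longrightarrow> y i = x i). D y) = (\<Sum>y\<in>?L. D y)"
      using supp line by (intro sum.mono_neutral_left) auto
    also have "\<dots> = int (\<Sum>y\<in>?L. count U y) - int (\<Sum>y\<in>?L. count V y)"
      by (simp add: D_def sum_subtractf)
    also have "\<dots> = 0"
      using count[of U] count[of V] proj[OF j] by simp
    finally show ?thesis .
  qed
  then have "2 ^ card J \<le> card {x. D x \<noteq> 0}"
    using finite_subset[OF supp] by (intro zero_line_sums_imp_large_support[where D = D, OF J _ x0]) auto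
  also have "\<dots> \<le> card (set_mset (U + V))"
    by (intro card_mono supp) simp
  also have "\<dots> \<le> size (U + V)"
    using sum_mono[of "set_mset (U + V)" "\<lambda>_. 1" "count (U + V)"]
    by (simp add: size_multiset_overloaded_eq Suc_le_eq)
  finally show False using size by simp
qed

text \<open>
  Induction on the number of rows: the facet projections of the columns in \<open>J\<close> are the columns in
  \<open>J - {j}\<close>. Sets with more than \<open>k\<close> rows satisfy the size condition of
  \<open>mset_eq_of_facet_projections_eq\<close>, as two multisets of \<open>n\<close> columns have size \<open>2 n\<close> together.
\<close>
lemma columns_eq_of_small_projections:
  assumes small: "2 * n < 2 ^ (k + 1)"
    and proj: "\<And>J. J \<subseteq> M \<Longrightarrow> card J = k \<Longrightarrow> columns n J u = columns n J v"
    and M: "finite M" "k \<le> card M"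
  shows "columns n M u = columns n M v"
proof -
  have "columns n J u = columns n J v" if "J \<subseteq> M" "card J = d + k" for J d
    using that
  proof (induction d arbitrary: J)
    case 0
    then show ?case using proj by simp
  next
    case (Suc d)
    have J: "finite J" using Suc.prems(1) M(1) by (rule finite_subset)
    show ?case
    proof (rule mset_eq_of_facet_projections_eq[OF J])
      show "set_mset (columns n J u + columns n J v) \<subseteq> extensional J"
        by (auto dest: columns_extensional)
    next
      fix j assume j: "j \<in> J"
      have "columns n (J - {j}) u = columns n (J - {j}) v"
        using Suc.prems j J by (intro Suc.IH) auto
      then show "image_mset (\<lambda>y. restrict y (J - {j})) (columns n J u) =
          image_mset (\<lambda>y. restrict y (J - {j})) (columns n J v)"
        by (simp add: image_restrict_columns)
    next
      have "(2::nat) ^ (k + 1) \<le> 2 ^ card J"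
        using Suc.prems(2) by (intro power_increasing) auto
      with small show "size (columns n J u) + size (columns n J v) < 2 ^ card J"
        by (simp add: size_columns)
    qed
  qed
  from this[of M "card M - k"] M(2) show ?thesis by simp
qed

section \<open>Expansion preserves separation\<close>

text \<open>Every set of \<open>m0\<close> rows is listed by an admissible tuple, namely in increasing order.\<close>
lemma obtain_admissible:
  assumes "J \<subseteq> {1..m}" "card J = m0"
  obtains js where "admissible m0 m js" "js ` {1..m0} = J" "inj_on js {1..m0}"
proof -
  have "finite J" using assms(1) by (rule finite_subset) simp
  then obtain h where h: "bij_betw h {..<m0} J" "strict_mono_on {..<m0} h"
    using ex_bij_betw_strict_mono_card[of J] assms(2) by metis
  \<comment> \<open>\<open>h\<close> counts from 0, admissible tuples count from 1\<close>
  define js where "js = restrict (\<lambda>l. h (l - 1)) {1..m0}"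
  have "bij_betw (\<lambda>l. l - 1) {1..m0} {..<m0}"
    by (rule bij_betw_byWitness[where f' = Suc]) auto
  then have "bij_betw (h \<circ> (\<lambda>l. l - 1)) {1..m0} J" using h(1) by (rule bij_betw_trans)
  then have bij: "bij_betw js {1..m0} J"
    by (rule bij_betw_cong[THEN iffD1, rotated]) (simp add: js_def)
  have "strict_mono_on {1..m0} js"
  proof (rule strict_mono_onI)
    fix r s assume "r \<in> {1..m0}" "s \<in> {1..m0}" "r < s"
    moreover from this have "h (r - 1) < h (s - 1)"
      by (intro strict_mono_onD[OF h(2)]) auto
    ultimately show "js r < js s" by (simp add: js_def)
  qed
  moreover have "js \<in> {1..m0} \<rightarrow>\<^sub>E {1..m}"
    using bij assms(1) by (auto simp: js_def bij_betw_def)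
  ultimately show ?thesis
    using bij that by (auto simp: admissible_def bij_betw_def)
qed

text \<open>
  The point of \<open>V\<^sup>m\<^sup>0\<close> formed by the rows \<open>js\<close> of \<open>u\<close>; evaluation at it is dual to expansion along
  \<open>js\<close>.
\<close>
definition pullback :: "nat \<Rightarrow> (nat \<Rightarrow> nat) \<Rightarrow> (nat \<Rightarrow> nat \<Rightarrow> 'k) \<Rightarrow> nat \<Rightarrow> nat \<Rightarrow> 'k" where
  "pullback m0 js u = restrict (\<lambda>l. u (js l)) {1..m0}"

lemma pullback_Vpow: "u \<in> Vpow n m \<Longrightarrow> admissible m0 m js \<Longrightarrow> pullback m0 js u \<in> Vpow n m0"
  unfolding Vpow_def pullback_def admissible_def by (intro restrict_PiE_iff[THEN iffD2]) auto

lemma meval_expand_at_pullback: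
  assumes "f \<in> multisym n m0"
  shows "meval (expand_at js f) u = meval f (pullback m0 js u)"
  unfolding meval_expand_at unfolding meval_def using assms
  by (intro mhom_cong) (auto simp: pullback_def multisym_def coord_ring_def)

text \<open>
  The columns of the pullback are indexed by \<open>{1..m0}\<close> instead of \<open>J\<close>; as \<open>js\<close> is injective,
  relabelling their entries by its inverse recovers the columns in the rows \<open>J\<close>.
\<close>
lemma columns_eq_of_pullback:
  assumes eq: "columns n {1..m0} (pullback m0 js u) = columns n {1..m0} (pullback m0 js v)"
    and js: "inj_on js {1..m0}" "js ` {1..m0} = J"
  shows "columns n J u = columns n J v"
proof -
  let ?g = "\<lambda>y. restrict (\<lambda>j. y (the_inv_into {1..m0} js j)) J"
  have inv: "the_inv_into {1..m0} js j \<in> {1..m0}" "js (the_inv_into {1..m0} js j) = j"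
    if "j \<in> J" for j
    using that js the_inv_into_into[OF js(1), of j] f_the_inv_into_f[OF js(1), of j] by blast+
  have "columns n J w = image_mset ?g (columns n {1..m0} (pullback m0 js w))" for w :: "nat \<Rightarrow> nat \<Rightarrow> 'a"
    unfolding columns_def multiset.map_comp comp_def
  proof (intro image_mset_cong restrict_ext)
    fix i j assume "j \<in> J"
    with inv[of j] show "w j i = restrict (\<lambda>j. pullback m0 js w j i) {1..m0} (the_inv_into {1..m0} js j)"
      by (simp add: pullback_def)
  qed
  with eq show ?thesis by simp
qed

lemma two_power_gt:
  fixes n m0 :: nat
  shows "m0 \<ge> n div 2 + 1 \<Longrightarrow> 2 * n < 2 ^ (m0 + 1)"
proof -
  assume m0: "m0 \<ge> n div 2 + 1"
  have "n div 2 < 2 ^ (n div 2)" by (rule less_exp)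
  then have "n < 2 * 2 ^ (n div 2)" by presburger
  then have "2 * n < 2 ^ (n div 2 + 1 + 1)" by simp
  also have "\<dots> \<le> 2 ^ (m0 + 1)" using m0 by (intro power_increasing) auto
  finally show ?thesis .
qed

theorem theorem1:
  fixes n m0 :: nat and S :: "'k::field mpoly set"
  assumes "n \<ge> 1"
    and "m0 \<ge> n div 2 + 1"
    and "S \<subseteq> multisym n m0"
    and "separating n m0 S"
  shows "\<forall>m\<ge>m0. separating n m (expansion m0 m S)"
proof (intro allI impI)
  fix m assume m: "m0 \<le> m"
  have "expansion m0 m S \<subseteq> multisym n m"
    using assms(3) unfolding expansion_def admissible_def
    by (auto intro!: expand_at_multisym simp: PiE_def)
  moreover have "separated_by (expansion m0 m S) u v"
    if u: "u \<in> Vpow n m" and v: "v \<in> Vpow n m" and sep: "separated_by (multisym n m) u v"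
    for u v
  proof (rule ccontr)
    assume not_sep: "\<not> separated_by (expansion m0 m S) u v"
    have "columns n {1..m} u = columns n {1..m} v"
    proof (rule columns_eq_of_small_projections[OF two_power_gt[OF assms(2)]])
      fix J assume J: "J \<subseteq> {1..m}" "card J = m0"
      obtain js where js: "admissible m0 m js" "js ` {1..m0} = J" "inj_on js {1..m0}"
        by (rule obtain_admissible[OF J])
      have "meval f (pullback m0 js u) = meval f (pullback m0 js v)" if "f \<in> S" for f
      proof -
        have "expand_at js f \<in> expansion m0 m S"
          using that js(1) by (auto simp: expansion_def)
        then have "meval (expand_at js f) u = meval (expand_at js f) v"
          using not_sep by (auto simp: separated_by_def)
        with that assms(3) show ?thesis by (auto simp: meval_expand_at_pullback)
      qed
      then have "\<not> separated_by S (pullback m0 js u) (pullback m0 js v)"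
        by (simp add: separated_by_def)
      then have "\<not> separated_by (multisym n m0) (pullback m0 js u) (pullback m0 js v)"
        using assms(4) pullback_Vpow[OF u js(1)] pullback_Vpow[OF v js(1)]
        by (auto simp: separating_def)
      then show "columns n J u = columns n J v"
        using js by (auto simp: separated_by_multisym_iff intro: columns_eq_of_pullback)
    qed (use m in auto)
    with sep show False by (simp add: separated_by_multisym_iff)
  qed
  ultimately show "separating n m (expansion m0 m S)"
    by (simp add: separating_def)
qed

end
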